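(* Let $G$ be a connected graph. If $\alpha(G)\le 4$, then $G$ has a Gallai vertex. Equivalently, $5P_1$ is a fixer.
   Context: All graphs are finite and simple. $\alpha(G)$ is the independence number of $G$. A vertex $v$ of a graph $G$ is a Gallai vertex if every longest path in $G$ contains $v$. $5P_1$ is the graph with $5$ vertices and no edges. A graph is $H$-free if it has no induced subgraph isomorphic to $H$; a graph $H$ is a fixer if every connected $H$-free graph has a Gallai vertex. *)

theory Defs
  imports
    "Graph_Theory.Pair_Digraph"
    "Graph_Theory.Digraph_Component"
    "Graph_Theory.Digraph_Isomorphism"
    "Graph_Theory.Vertex_Walk"
begin

text \<open>
  Finite simple graphs are rendered by the locale \<^locale>\<open>pair_graph\<close>: finite, symmetric,
  loop-free sets of pairs, where an edge between \<open>u\<close> and \<open>v\<close> is present as both \<open>(u, v)\<close> and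
  \<open>(v, u)\<close>. The null graph is a \<^locale>\<open>pair_graph\<close>, but it is not connected, since
  \<^const>\<open>Digraph_Component.connected\<close> demands a vertex. Vertex paths
  (\<^const>\<open>vpath\<close>) are nonempty.
\<close>

definition independent_set :: "'a pair_pre_digraph \<Rightarrow> 'a set \<Rightarrow> bool" where
  "independent_set G S \<longleftrightarrow> S \<subseteq> pverts G \<and> (\<forall>u\<in>S. \<forall>v\<in>S. (u, v) \<notin> parcs G)"

definition independence_number :: "'a pair_pre_digraph \<Rightarrow> nat" where
  "independence_number G = Max (card ` {S. independent_set G S})"

definition longest_path :: "'a pair_pre_digraph \<Rightarrow> 'a list \<Rightarrow> bool" where
  "longest_path G p \<longleftrightarrow>
     vpath p (with_proj G) \<and> (\<forall>q. vpath q (with_proj G) \<longrightarrow> vwalk_length q \<le> vwalk_length p)"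

definition gallai_vertex :: "'a pair_pre_digraph \<Rightarrow> 'a \<Rightarrow> bool" where
  "gallai_vertex G v \<longleftrightarrow> v \<in> pverts G \<and> (\<forall>p. longest_path G p \<longrightarrow> v \<in> set p)"

definition edgeless_graph :: "nat \<Rightarrow> nat pair_pre_digraph" where
  "edgeless_graph n = \<lparr> pverts = {..<n}, parcs = {} \<rparr>"

definition induced_free :: "'b pair_pre_digraph \<Rightarrow> 'a pair_pre_digraph \<Rightarrow> bool" where
  "induced_free H G \<longleftrightarrow>
     \<not> (\<exists>K. induced_subgraph K (with_proj G) \<and> digraph_iso K (with_proj H))"

text \<open>
  A predicate cannot quantify over all types, so the vertex type of the graphs \<open>G\<close> is passed as
  an argument; a statement \<open>fixer TYPE('a) H\<close> with \<open>'a\<close> a type variable covers all of them.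
\<close>

definition fixer :: "'a itself \<Rightarrow> 'b pair_pre_digraph \<Rightarrow> bool" where
  "fixer _ H \<longleftrightarrow> pair_graph H \<and>
     (\<forall>G :: 'a pair_pre_digraph.
        pair_graph G \<longrightarrow> Digraph_Component.connected (with_proj G) \<longrightarrow> induced_free H G \<longrightarrow>
        (\<exists>v. gallai_vertex G v))"

end

theory Submission
  imports Defs
begin

text \<open>
  For a longest path \<open>P\<close> and a component \<open>H\<close> of \<open>G - P\<close>, let \<open>N(H)\<close> be the set of neighbours of
  \<open>H\<close> outside \<open>H\<close>; they all lie on \<open>P\<close>. The classical rerouting argument shows that the first vertex
  of \<open>P\<close>, the successors on \<open>P\<close> of the vertices in \<open>N(H)\<close>, and any independent subset \<open>I\<close> of \<open>H\<close>
  together are independent (\<open>indep_certificate\<close>). So \<open>\<alpha>(G) \<le> 4\<close> gives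
  \<open>|N(H)| + |I| \<le> 3\<close>. In particular \<open>|N(H)| \<le> 2\<close>, and \<open>H\<close> is a clique if \<open>|N(H)| = 2\<close>.

  If no longest path misses a vertex, every vertex is a Gallai vertex. Otherwise choose a pair \<open>(P, H)\<close>
  that maximises first \<open>|N(H)|\<close> and then \<open>|H|\<close>. As \<open>G\<close> is connected, \<open>N(H)\<close> is not empty, and every
  \<open>a \<in> N(H)\<close> is a Gallai vertex
  (\<open>boundary_of_maximal_piece_gallai\<close>). For suppose that a longest path \<open>Q\<close> misses \<open>a\<close>, and let
  \<open>K\<close> be the component of \<open>G - Q\<close> that contains \<open>a\<close>. Two longest paths of a connected graph meet,
  so \<open>P\<close> leaves \<open>K\<close> through some \<open>c \<in> N(K)\<close>.

  \<^item> If \<open>Q\<close> avoids \<open>H\<close>, then \<open>K\<close> contains \<open>H\<close> and \<open>a\<close>, so it is larger than \<open>H\<close>. By the choice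
    of the pair, \<open>N(K) = {c}\<close> and \<open>N(H) = {a, b}\<close> for some \<open>b\<close>. Now \<open>K\<close> contains \<open>b\<close> unless
    \<open>b = c\<close>, and it contains every side of \<open>c\<close> on \<open>P\<close> that it meets. Hence at least three of the four
    independent vertices attached to \<open>(P, H)\<close> lie in \<open>K\<close> (\<open>two_certificate_vertices\<close>), which
    contradicts the bound \<open>1 + |I| \<le> 3\<close> for \<open>(Q, K)\<close>.

  \<^item> If \<open>Q\<close> meets \<open>H\<close>, it leaves \<open>H\<close> through a vertex \<open>b \<noteq> a\<close>, so \<open>N(H) = {a, b}\<close>, \<open>H\<close> is a
    clique, and an end of \<open>Q\<close> lies in \<open>H\<close>. Any vertex of \<open>H\<close> off \<open>Q\<close> could be appended at this end, so
    \<open>Q\<close> covers \<open>H\<close>. A neighbour of \<open>a\<close> in \<open>H\<close> is thus a vertex of \<open>N(K)\<close> other than \<open>c\<close>, whence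
    \<open>|N(K)| = 2\<close> and \<open>|K| \<le> |H|\<close>. But the side of \<open>c\<close> on \<open>P\<close> that contains \<open>a\<close> lies in \<open>K\<close>, and it
    has more than \<open>|H|\<close> vertices: \<open>a\<close> itself and one complete arm of \<open>P\<close> at \<open>a\<close>. That arm is at
    least as long as the clique \<open>H\<close>, which could replace it.
\<close>

section \<open>Paths in finite connected graphs\<close>

text \<open>
  The combinatorial argument uses adjacency only as a binary relation, so that paths are lists whose
  consecutive entries are related.
\<close>

locale finite_connected_graph =
  fixes V :: "'a set" and E :: "'a \<Rightarrow> 'a \<Rightarrow> bool"
  assumes finite_V: "finite V"
    and edge_in_V: "E u v \<Longrightarrow> u \<in> V"
    and edge_sym: "E u v \<Longrightarrow> E v u"
    and edge_irrefl: "\<not> E v v"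
    and connected: "u \<in> V \<Longrightarrow> v \<in> V \<Longrightarrow> E\<^sup>*\<^sup>* u v"
begin

definition path :: "'a list \<Rightarrow> bool" where
  "path p \<longleftrightarrow> p \<noteq> [] \<and> distinct p \<and> set p \<subseteq> V \<and> successively E p"

definition longest :: "'a list \<Rightarrow> bool" where
  "longest p \<longleftrightarrow> path p \<and> (\<forall>q. path q \<longrightarrow> length q \<le> length p)"

definition indep :: "'a set \<Rightarrow> bool" where
  "indep S \<longleftrightarrow> S \<subseteq> V \<and> (\<forall>u\<in>S. \<forall>v\<in>S. \<not> E u v)"

definition boundary :: "'a set \<Rightarrow> 'a set" where
  "boundary A = {v \<in> V - A. \<exists>u\<in>A. E v u}"

definition linked :: "'a set \<Rightarrow> bool" where
  "linked A \<longleftrightarrow> (\<forall>u\<in>A. \<forall>v\<in>A. \<exists>r. path r \<and> hd r = u \<and> last r = v \<and> set r \<subseteq> A)"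

text \<open>
  Given that \<open>H\<close> is disjoint from \<open>p\<close> and linked, the condition on its boundary says that \<open>H\<close> is a
  full component of the graph minus \<open>p\<close>.
\<close>

definition piece :: "'a list \<Rightarrow> 'a set \<Rightarrow> bool" where
  "piece p H \<longleftrightarrow> H \<noteq> {} \<and> H \<subseteq> V \<and> linked H \<and> H \<inter> set p = {} \<and> boundary H \<subseteq> set p"

lemma successively_rev_E [simp]: "successively E (rev xs) = successively E xs"
proof -
  have "(\<lambda>x y. E y x) = E" using edge_sym by blast
  from arg_cong[OF this, of "\<lambda>R. successively R xs"] show ?thesis by (simp only: successively_rev)
qed

declare successively_rev [simp del]

lemma path_rev [simp]: "path (rev p) \<longleftrightarrow> path p"
  by (simp add: path_def)

lemma edge_commute: "E u v \<longleftrightarrow> E v u"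
  using edge_sym by blast

lemma longest_rev: "longest p \<Longrightarrow> longest (rev p)"
  by (simp add: longest_def)

lemma piece_rev: "piece p H \<Longrightarrow> piece (rev p) H"
  by (simp add: piece_def)

lemma longest_path: "longest p \<Longrightarrow> path p"
  by (simp add: longest_def)

lemma longest_length: "longest p \<Longrightarrow> path q \<Longrightarrow> length q \<le> length p"
  by (simp add: longest_def)

lemma path_singleton [simp]: "path [v] \<longleftrightarrow> v \<in> V"
  by (simp add: path_def)

lemma path_Cons: "path (v # p) \<longleftrightarrow> v \<in> V \<and> (p = [] \<or> path p \<and> v \<notin> set p \<and> E v (hd p))"
  by (auto simp: path_def successively_Cons)

lemma path_append:
  "p \<noteq> [] \<Longrightarrow> q \<noteq> [] \<Longrightarrow>
    path (p @ q) \<longleftrightarrow> path p \<and> path q \<and> set p \<inter> set q = {} \<and> E (last p) (hd q)"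
  by (auto simp: path_def successively_append_iff)

lemma boundary_edge: "a \<in> boundary A \<Longrightarrow> \<exists>u\<in>A. E a u"
  by (auto simp: boundary_def)

text \<open>
  Shortcuts a walk as it is built: a step back to a vertex already visited truncates the path at
  that vertex.
\<close>

lemma walk_to_path:
  assumes "(\<lambda>x y. E x y \<and> y \<in> A)\<^sup>*\<^sup>* u v" "u \<in> A" "u \<in> V"
  shows "\<exists>r. path r \<and> hd r = u \<and> last r = v \<and> set r \<subseteq> A"
  using assms(1)
proof induction
  case base
  show ?case using assms by (intro exI[of _ "[u]"]) simp
next
  case (step y z)
  then obtain r where r: "path r" "hd r = u" "last r = y" "set r \<subseteq> A" by blast
  have ne: "r \<noteq> []" using r(1) by (simp add: path_def)
  show ?case
  proof (cases "z \<in> set r")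
    case True
    then obtain xs ys where xy: "r = xs @ z # ys" by (meson split_list)
    have "path (xs @ [z])" using r(1) by (auto simp: xy path_def successively_append_iff successively_Cons)
    moreover have "hd (xs @ [z]) = u" using r(2) by (cases xs) (auto simp: xy)
    ultimately show ?thesis using r(4) by (intro exI[of _ "xs @ [z]"]) (auto simp: xy)
  next
    case False
    have "z \<in> V" using step(2) edge_in_V edge_sym by blast
    then have "path (r @ [z])" using ne r(1,3) False step(2) by (simp add: path_append)
    then show ?thesis using ne r step(2) by (intro exI[of _ "r @ [z]"]) auto
  qed
qed

section \<open>Components of the complement of a path\<close>

definition component :: "'a list \<Rightarrow> 'a \<Rightarrow> 'a set" where
  "component p v = {u. (\<lambda>x y. E x y \<and> x \<notin> set p \<and> y \<notin> set p)\<^sup>*\<^sup>* v u}"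

lemma piece_component:
  assumes "v \<in> V" "v \<notin> set p"
  shows "piece p (component p v)" and "v \<in> component p v"
proof -
  let ?R = "\<lambda>x y. E x y \<and> x \<notin> set p \<and> y \<notin> set p"
  let ?C = "component p v"
  show mem: "v \<in> ?C" by (simp add: component_def)
  have sub: "?C \<subseteq> V - set p"
  proof
    fix u assume "u \<in> ?C"
    then have "?R\<^sup>*\<^sup>* v u" by (simp add: component_def)
    then show "u \<in> V - set p"
      by induction (use assms edge_in_V edge_sym in blast)+
  qed
  have sym: "?R\<^sup>*\<^sup>* x y \<Longrightarrow> ?R\<^sup>*\<^sup>* y x" for x y
    by (rule sympD[OF symp_rtranclp]) (auto simp: symp_def intro: edge_sym)
  have "\<exists>r. path r \<and> hd r = x \<and> last r = y \<and> set r \<subseteq> ?C" if "x \<in> ?C" "y \<in> ?C" for x y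
  proof (rule walk_to_path)
    show "x \<in> ?C" "x \<in> V" using that sub by auto
    have vx: "?R\<^sup>*\<^sup>* v x" and vy: "?R\<^sup>*\<^sup>* v y"
      using that by (simp_all add: component_def)
    have "?R\<^sup>*\<^sup>* x y" by (rule rtranclp_trans[OF sym[OF vx] vy])
    then show "(\<lambda>x y. E x y \<and> y \<in> ?C)\<^sup>*\<^sup>* x y"
    proof induction
      case (step y z)
      have "?R\<^sup>*\<^sup>* v z"
        by (rule rtranclp_trans[OF vx rtranclp.rtrancl_into_rtrancl[OF step(1,2)]])
      then have "E y z \<and> z \<in> ?C" using step(2) by (simp add: component_def)
      with step.IH show ?case by (rule rtranclp.rtrancl_into_rtrancl)
    qed simp
  qed
  moreover have "boundary ?C \<subseteq> set p"
  proof
    fix w assume w: "w \<in> boundary ?C"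
    then obtain u where u: "u \<in> ?C" "E w u" "w \<notin> ?C" by (auto simp: boundary_def)
    show "w \<in> set p"
    proof (rule ccontr)
      assume "w \<notin> set p"
      then have "?R u w" using u sub edge_sym by blast
      with u(1) have "w \<in> ?C"
        unfolding component_def mem_Collect_eq by (rule rtranclp.rtrancl_into_rtrancl)
      then show False using u by simp
    qed
  qed
  ultimately show "piece p ?C" using mem sub by (auto simp: piece_def linked_def)
qed

text \<open>
  An edge that leaves or enters \<open>K\<close> has its outer end in the boundary.
\<close>

lemma path_in_or_out:
  assumes "path q" "set q \<inter> boundary K = {}" "set q \<inter> K \<noteq> {}"
  shows "set q \<subseteq> K"
  using assms
proof (induction q)
  case (Cons v q)
  show ?case
  proof (cases "q = []")
    case False
    then have q: "path q" "E v (hd q)" "v \<in> V" using Cons.prems by (auto simp: path_Cons)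
    have hq: "hd q \<in> set q" "hd q \<in> V" using False q(1) by (auto simp: path_def)
    show ?thesis
    proof (cases "set q \<inter> K = {}")
      case True
      then have "v \<in> K" using Cons.prems by auto
      then have "hd q \<in> boundary K" using True q(2) hq edge_sym by (auto simp: boundary_def)
      then show ?thesis using Cons.prems hq by auto
    next
      case ne: False
      then have "set q \<subseteq> K" using Cons q by auto
      then have "v \<in> K \<or> v \<in> boundary K" using q hq by (auto simp: boundary_def)
      then show ?thesis using \<open>set q \<subseteq> K\<close> Cons.prems by auto
    qed
  qed (use Cons in auto)
qed simp

text \<open>
  A path that meets the boundary of \<open>K\<close> in \<open>c\<close> at most can cross between \<open>K\<close> and the rest only at \<open>c\<close>.
\<close>

lemma sides_in_or_out:
  assumes "path (xs @ c # ys)" "set (xs @ c # ys) \<inter> boundary K \<subseteq> {c}"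
  shows "set xs \<inter> K \<noteq> {} \<Longrightarrow> set xs \<subseteq> K" and "set ys \<inter> K \<noteq> {} \<Longrightarrow> set ys \<subseteq> K"
proof -
  have "path xs" if "xs \<noteq> []" using assms(1) that by (simp add: path_append)
  moreover have "path ys" if "ys \<noteq> []"
    using assms(1) that by (auto simp: path_def successively_append_iff successively_Cons)
  moreover have "c \<notin> set xs" "c \<notin> set ys" using assms(1) by (auto simp: path_def)
  ultimately show "set xs \<inter> K \<noteq> {} \<Longrightarrow> set xs \<subseteq> K" "set ys \<inter> K \<noteq> {} \<Longrightarrow> set ys \<subseteq> K"
    using assms(2) path_in_or_out[of xs K] path_in_or_out[of ys K] by fastforce+
qed

lemma boundary_nonempty:
  assumes "A \<noteq> {}" "A \<subseteq> V" "\<not> V \<subseteq> A"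
  shows "boundary A \<noteq> {}"
proof
  assume b: "boundary A = {}"
  obtain u v where u: "u \<in> A" and v: "v \<in> V" "v \<notin> A" using assms by blast
  have "E\<^sup>*\<^sup>* u v" using u v assms connected by blast
  then have "v \<in> A"
  proof induction
    case (step y z)
    then have "E z y" "z \<in> V" using edge_sym edge_in_V by blast+
    then show ?case using step.IH b by (auto simp: boundary_def)
  qed (rule u)
  then show False using v by simp
qed

lemma piece_boundary_nonempty: "longest p \<Longrightarrow> piece p H \<Longrightarrow> boundary H \<noteq> {}"
  by (rule boundary_nonempty) (auto simp: piece_def longest_def path_def neq_Nil_conv)

lemma path_split: 
  "path (xs @ a # ys) \<Longrightarrow> path (xs @ [a])" "path (xs @ a # ys) \<Longrightarrow> path (a # ys)"
  by (auto simp: path_def successively_append_iff successively_Cons)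

text \<open>
  If \<open>p\<close> and \<open>q\<close> were disjoint, a bridge from \<open>p\<close> to \<open>q\<close> through the component containing \<open>q\<close> could be
  combined with the longer arm of \<open>p\<close> at one of its ends and the longer arm of \<open>q\<close> at the other. Each
  arm together with its attaching vertex has more than half of the vertices of its path, so the result
  is too long.
\<close>

lemma longest_paths_meet:
  assumes "longest p" "longest q"
  shows "set p \<inter> set q \<noteq> {}"
proof
  assume dis: "set p \<inter> set q = {}"
  have pp: "path p" "path q" using assms by (auto simp: longest_def)
  obtain v where v: "v \<in> set q" "v \<in> V" using pp(2) by (cases q) (auto simp: path_def)
  then have vp: "v \<notin> set p" using dis by auto
  let ?K = "component p v"
  note K = piece_component[OF v(2) vp]
  have qK: "set q \<subseteq> ?K"
    using path_in_or_out[OF pp(2), of ?K] K v dis by (auto simp: piece_def)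
  obtain a where a: "a \<in> boundary ?K" using piece_boundary_nonempty[OF assms(1) K(1)] by blast
  then obtain k where k: "k \<in> ?K" "E a k" using boundary_edge by blast
  have "a \<in> set p" using a K by (auto simp: piece_def)
  then obtain xs ys where p: "p = xs @ a # ys" by (meson split_list)
  obtain r where r: "path r" "hd r = k" "last r = v" "set r \<subseteq> ?K"
    using K k unfolding piece_def linked_def by metis
  have "last r \<in> set r" using r(1) by (simp add: path_def)
  then have "\<exists>x\<in>set r. x \<in> set q" using r(3) v(1) by blast
  from split_list_first_prop[OF this] obtain r1 b r2 where rb: "r = r1 @ b # r2" "b \<in> set q" "\<forall>x\<in>set r1. x \<notin> set q"
    by blast
  obtain zs ws where q: "q = zs @ b # ws" using rb(2) by (meson split_list)
  have disj: "set p \<inter> ?K = {}" using K by (auto simp: piece_def)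
  \<comment> \<open>the longer arm of each path at its end of the bridge, oriented so that the two arms fit
    before and after the bridge\<close>
  define A where "A = (if length ys \<le> length xs then xs else rev ys)"
  define B where "B = (if length zs \<le> length ws then ws else rev zs)"
  have arms: "path (xs @ [a])" "path (a # ys)" "path (zs @ [b])" "path (b # ws)"
    using pp p q path_split by auto
  moreover have "path (rev (a # ys))" "path (rev (zs @ [b]))"
    using arms by (simp_all only: path_rev)
  ultimately have A: "path (A @ [a])" "set A \<subseteq> set p" and B: "path (b # B)" "set (b # B) \<subseteq> set q"
    by (auto simp: A_def B_def p q)
  have h: "E a (hd (r1 @ b # B))" using k(2) r(2) rb(1) by (cases r1) auto
  have r1b: "path (r1 @ [b])" using r(1) rb(1) path_split by blast
  have "path (r1 @ b # B)"
  proof (cases "r1 = []")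
    case False
    then have "path r1" "E (last r1) b" using r1b by (auto simp: path_append)
    then show ?thesis using False B rb(3) by (subst path_append) auto
  qed (use B in simp)
  moreover have "set (r1 @ b # B) \<subseteq> ?K" using r(4) rb(1) B qK by auto
  moreover have "set (A @ [a]) \<subseteq> set p" using A(2) \<open>a \<in> set p\<close> by simp
  ultimately have "path ((A @ [a]) @ (r1 @ b # B))"
    using path_append[of "A @ [a]" "r1 @ b # B"] A(1) h disj by auto
  from longest_length[OF assms(1) this] longest_length[OF assms(2) this]
  have "length A + length B + 2 \<le> length p" "length A + length B + 2 \<le> length q" by simp_all
  moreover have "length p \<le> 2 * length A + 1" "length q \<le> 2 * length B + 1"
    by (simp_all add: A_def B_def p q)
  ultimately show False by linarith
qed

section \<open>Rerouting a longest path through a component\<close>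

lemma boundary_inner:
  assumes "longest (xs @ a # ys)" "piece (xs @ a # ys) H" "a \<in> boundary H"
  shows "xs \<noteq> []" "ys \<noteq> []"
proof -
  obtain h where h: "h \<in> H" "E a h" using boundary_edge[OF assms(3)] by blast
  have hp: "h \<notin> set (xs @ a # ys)" "h \<in> V" using h(1) assms(2) by (auto simp: piece_def)
  have pa: "path (xs @ a # ys)" using assms(1) by (rule longest_path)
  show "xs \<noteq> []"
  proof
    assume "xs = []"
    then have "path (h # xs @ a # ys)" using pa hp h edge_sym by (auto simp: path_Cons)
    from longest_length[OF assms(1) this] show False by simp
  qed
  show "ys \<noteq> []"
  proof
    assume "ys = []"
    then have "path ((xs @ a # ys) @ [h])" using pa hp h by (subst path_append) auto
    from longest_length[OF assms(1) this] show False by simp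
  qed
qed

lemma detour:
  assumes "piece p H" "a \<in> boundary H" "b \<in> boundary H"
  obtains r where "path r" "E a (hd r)" "E (last r) b" "set r \<inter> set p = {}"
proof -
  obtain h k where hk: "h \<in> H" "E a h" "k \<in> H" "E b k" using assms boundary_edge by meson
  then obtain r where "path r" "hd r = h" "last r = k" "set r \<subseteq> H"
    using assms(1) unfolding piece_def linked_def by meson
  moreover from this have "set r \<inter> set p = {}" using assms(1) by (auto simp: piece_def)
  ultimately show thesis using that[of r] hk edge_sym by auto
qed

lemma boundary_not_consecutive:
  assumes "longest (xs @ a # b # ys)" "piece (xs @ a # b # ys) H" "a \<in> boundary H"
  shows "b \<notin> boundary H"
proof
  assume "b \<in> boundary H"
  with detour[OF assms(2,3)] obtain r where
    r: "path r" "E a (hd r)" "E (last r) b" "set r \<inter> set (xs @ a # b # ys) = {}" by metis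
  have "path (xs @ a # r @ b # ys)"
    using longest_path[OF assms(1)] r
    by (auto simp: path_def successively_append_iff successively_Cons)
  from longest_length[OF assms(1) this] show False using r(1) by (auto simp: path_def)
qed

text \<open>
  An edge from the start of the path to \<open>c\<close> lets one traverse the initial part backwards: enter
  from \<open>H\<close> at \<open>a\<close>, run back to the start, and jump to \<open>c\<close>.
\<close>

lemma start_not_adjacent_successor:
  assumes "longest (xs @ a # c # ys)" "piece (xs @ a # c # ys) H" "a \<in> boundary H"
  shows "\<not> E (hd (xs @ a # c # ys)) c"
proof
  assume e: "E (hd (xs @ a # c # ys)) c"
  have xs: "xs \<noteq> []" using boundary_inner(1)[OF assms] .
  obtain h where h: "h \<in> H" "E a h" using boundary_edge[OF assms(3)] by blast
  have hp: "h \<notin> set (xs @ a # c # ys)" "h \<in> V" using h(1) assms(2) by (auto simp: piece_def)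
  have "path (h # a # rev xs @ c # ys)"
    using longest_path[OF assms(1)] hp h e xs
    by (auto simp: path_def successively_append_iff successively_Cons hd_rev last_rev edge_commute)
  from longest_length[OF assms(1) this] show False by simp
qed

lemma path_reroute:
  assumes "path (X @ Y @ Z)" "path r" "X \<noteq> []" "Y \<noteq> []" "Z \<noteq> []"
    and "E (last X) (hd r)" "E (last r) (last Y)" "E (hd Y) (hd Z)"
    and "set r \<inter> set (X @ Y @ Z) = {}"
  shows "path (X @ r @ rev Y @ Z)"
proof -
  have "r \<noteq> []" using assms(2) by (simp add: path_def)
  then show ?thesis using assms
    by (simp add: path_append hd_rev last_rev Int_Un_distrib Int_commute)
qed

text \<open>
  An edge between the successors \<open>c\<close> of \<open>a\<close> and \<open>d\<close> of \<open>b\<close> closes the detour: go from \<open>a\<close> through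
  \<open>H\<close> to \<open>b\<close>, back along the path to \<open>c\<close>, and jump to \<open>d\<close>.
\<close>

lemma successors_not_adjacent:
  assumes "longest (xs @ a # c # ys @ b # d # zs)" "piece (xs @ a # c # ys @ b # d # zs) H"
    "a \<in> boundary H" "b \<in> boundary H"
  shows "\<not> E c d"
proof
  assume e: "E c d"
  from detour[OF assms(2,3,4)] obtain r where
    r: "path r" "E a (hd r)" "E (last r) b"
      "set r \<inter> set (xs @ a # c # ys @ b # d # zs) = {}" by metis
  have "path ((xs @ [a]) @ r @ rev (c # ys @ [b]) @ (d # zs))"
    by (rule path_reroute) (use longest_path[OF assms(1)] r e in simp_all)
  from longest_length[OF assms(1) this] show False using r(1) by (simp add: path_def)
qed

end

section \<open>Successors on a longest path\<close>

lemma split_at_consecutive: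
  assumes "Suc i < length p"
  shows "p = take i p @ p ! i # p ! Suc i # drop (Suc (Suc i)) p"
  using assms by (metis Cons_nth_drop_Suc Suc_lessD append_take_drop_id)

lemma split_at_two_consecutive:
  assumes "Suc i < j" "Suc j < length p"
  shows "\<exists>xs ys zs. p = xs @ p ! i # p ! Suc i # ys @ p ! j # p ! Suc j # zs"
proof -
  have "take j p = take i p @ p ! i # p ! Suc i # drop (Suc (Suc i)) (take j p)"
    using split_at_consecutive[of i "take j p"] assms by simp
  then show ?thesis using split_at_consecutive[OF assms(2)] by (metis append.assoc append_Cons)
qed

context finite_connected_graph
begin

lemma boundary_index_inner:
  assumes "longest p" "piece p H" "i < length p" "p ! i \<in> boundary H"
  shows "0 < i" "Suc i < length p"
proof -
  note p = id_take_nth_drop[OF assms(3)]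
  have "take i p \<noteq> []" "drop (Suc i) p \<noteq> []"
    using boundary_inner[of "take i p" "p ! i" "drop (Suc i) p" H] assms p by auto
  then show "0 < i" "Suc i < length p" by auto
qed

lemma successor_not_boundary:
  assumes "longest p" "piece p H" "Suc i < length p" "p ! i \<in> boundary H"
  shows "p ! Suc i \<notin> boundary H"
  using boundary_not_consecutive[of "take i p" "p ! i" "p ! Suc i" "drop (Suc (Suc i)) p" H]
    assms split_at_consecutive[OF assms(3)] by simp

lemma start_not_adjacent_successor_index:
  assumes "longest p" "piece p H" "Suc i < length p" "p ! i \<in> boundary H"
  shows "\<not> E (p ! 0) (p ! Suc i)"
proof -
  have "p ! 0 = hd p" using assms(3) by (cases p) auto
  then show ?thesis
    using start_not_adjacent_successor[of "take i p" "p ! i" "p ! Suc i" "drop (Suc (Suc i)) p" H]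
      assms split_at_consecutive[OF assms(3)] by metis
qed

lemma successors_not_adjacent_index:
  assumes "longest p" "piece p H" "i < j" "Suc j < length p"
    and "p ! i \<in> boundary H" "p ! j \<in> boundary H"
  shows "\<not> E (p ! Suc i) (p ! Suc j)"
proof -
  have "Suc i \<noteq> j" using successor_not_boundary[OF assms(1,2) _ assms(5)] assms by auto
  then obtain xs ys zs where "p = xs @ p ! i # p ! Suc i # ys @ p ! j # p ! Suc j # zs"
    using split_at_two_consecutive[of i j p] assms by auto
  then show ?thesis using successors_not_adjacent assms by metis
qed

section \<open>The independent set of successors\<close>

text \<open>
  The start of \<open>p\<close> and the successors on \<open>p\<close> of the vertices in \<open>N\<close>. Taking images of positions makes
  its size visible: \<open>p\<close> is injective on positions, and \<open>0\<close> is not a successor.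
\<close>

definition certificate :: "'a list \<Rightarrow> 'a set \<Rightarrow> 'a set" where
  "certificate p N = (!) p ` insert 0 (Suc ` {i. i < length p \<and> p ! i \<in> N})"

text \<open>
  Hence \<open>|N(H)| + |I| + 1 \<le> \<alpha>(G)\<close> for every independent \<open>I \<subseteq> H\<close>. The rerouting lemmas make the
  certificate itself independent; it has no neighbours in \<open>H\<close> because none of its members is in the boundary of \<open>H\<close>.
\<close>

lemma indep_certificate:
  assumes p: "longest p" and H: "piece p H" and I: "I \<subseteq> H" "indep I"
  shows "indep (certificate p (boundary H) \<union> I)"
    and "card (certificate p (boundary H) \<union> I) = Suc (card (boundary H) + card I)"
proof -
  let ?J = "{i. i < length p \<and> p ! i \<in> boundary H}"
  let ?C = "certificate p (boundary H)"
  have pp: "distinct p" "set p \<subseteq> V" "p \<noteq> []" using p by (auto simp: longest_def path_def)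
  have Hp: "H \<subseteq> V" "H \<inter> set p = {}" "boundary H \<subseteq> set p" using H by (auto simp: piece_def)
  have idx: "insert 0 (Suc ` ?J) \<subseteq> {..<length p}"
    using boundary_index_inner(2)[OF p H] pp(3) by auto
  have Cp: "?C \<subseteq> set p" using idx by (auto simp: certificate_def)
  have C_not_N: "v \<notin> boundary H" if "v \<in> ?C" for v
    using that successor_not_boundary[OF p H] boundary_index_inner[OF p H] pp(3)
    by (auto simp: certificate_def)
  have C_H: "\<not> E v h" "\<not> E h v" if "v \<in> ?C" "h \<in> H" for v h
    using C_not_N[OF that(1)] Cp Hp pp that edge_sym by (auto simp: boundary_def)
  have ordered: "\<not> E (p ! i) (p ! j)" if ij: "i \<in> insert 0 (Suc ` ?J)" "j \<in> insert 0 (Suc ` ?J)" "i < j" for i j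
  proof -
    from ij obtain j' where j: "j = Suc j'" "p ! j' \<in> boundary H" "Suc j' < length p"
      using boundary_index_inner(2)[OF p H] by auto
    show ?thesis
    proof (cases "i = 0")
      case True
      then show ?thesis using start_not_adjacent_successor_index[OF p H] j by simp
    next
      case False
      then show ?thesis using successors_not_adjacent_index[OF p H] j ij by auto
    qed
  qed
  have "\<not> E (p ! i) (p ! j)" if "i \<in> insert 0 (Suc ` ?J)" "j \<in> insert 0 (Suc ` ?J)" for i j
    using ordered[OF that] ordered[OF that(2,1)] edge_irrefl edge_commute[of "p ! i" "p ! j"]
    by (cases i j rule: linorder_cases) blast+
  then have "\<forall>u\<in>?C. \<forall>v\<in>?C. \<not> E u v" unfolding certificate_def by blast
  then show "indep (?C \<union> I)" using C_H I Cp Hp pp unfolding indep_def by blast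
  have inj: "inj_on ((!) p) {..<length p}" using pp(1) by (simp add: inj_on_nth)
  have "boundary H = (!) p ` ?J" using Hp(3) by (fastforce simp: in_set_conv_nth)
  then have "card (boundary H) = card ?J"
    by (metis (no_types, lifting) card_image inj inj_on_subset lessThan_iff mem_Collect_eq subsetI)
  moreover have "card ?C = card (insert 0 (Suc ` ?J))"
    unfolding certificate_def by (rule card_image) (rule inj_on_subset[OF inj idx])
  ultimately have "card ?C = Suc (card (boundary H))" by (simp add: card_image)
  moreover have "finite ?C" "finite I" "?C \<inter> I = {}"
    using Cp Hp I finite_V finite_subset[of I V] by (auto intro: finite_subset)
  ultimately show "card (?C \<union> I) = Suc (card (boundary H) + card I)"
    by (simp add: card_Un_disjoint)
qed

section \<open>The maximal component\<close>

definition clique :: "'a set \<Rightarrow> bool" where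
  "clique A \<longleftrightarrow> (\<forall>u\<in>A. \<forall>v\<in>A. u \<noteq> v \<longrightarrow> E u v)"

lemma clique_successively: "clique A \<Longrightarrow> distinct l \<Longrightarrow> set l \<subseteq> A \<Longrightarrow> successively E l"
proof (induction l)
  case (Cons x l)
  then show ?case by (cases l) (auto simp: clique_def)
qed simp

text \<open>
  Otherwise \<open>xs\<close> could be replaced by all of \<open>H\<close>, traversed so as to end in a neighbour of \<open>a\<close>.
\<close>

lemma left_arm_at_boundary_of_clique:
  assumes p: "longest (xs @ a # ys)" and H: "piece (xs @ a # ys) H" and a: "a \<in> boundary H"
    and clique: "clique H"
  shows "card H \<le> length xs"
proof -
  obtain w where w: "w \<in> H" "E a w" using boundary_edge[OF a] by blast
  have HV: "H \<subseteq> V" "H \<inter> set (xs @ a # ys) = {}" using H by (auto simp: piece_def)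
  then have fin: "finite H" using finite_V finite_subset by blast
  obtain hs where hs: "set hs = H - {w}" "distinct hs"
    using finite_distinct_list[of "H - {w}"] fin by auto
  have l: "set (hs @ [w]) = H" "distinct (hs @ [w])" using hs w by auto
  have "path (hs @ [w])"
    using clique_successively[OF clique l(2) equalityD1[OF l(1)]] l(2) HV(1) l(1)
    by (auto simp: path_def)
  moreover have "path (a # ys)" using path_split(2)[OF longest_path[OF p]] .
  moreover have "set (hs @ [w]) \<inter> set (a # ys) = {}" using l(1) HV(2) by auto
  ultimately have "path ((hs @ [w]) @ a # ys)"
    using w(2) edge_sym by (subst path_append) auto
  from longest_length[OF p this] have "length (hs @ [w]) \<le> length xs" by simp
  then show ?thesis using distinct_card[OF l(2)] l(1) by simp
qed

lemma right_arm_at_boundary_of_clique: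
  assumes p: "longest (xs @ a # ys)" and H: "piece (xs @ a # ys) H" and a: "a \<in> boundary H"
    and clique: "clique H"
  shows "card H \<le> length ys"
  using left_arm_at_boundary_of_clique[of "rev ys" a "rev xs" H]
    longest_rev[OF p] piece_rev[OF H] a clique by simp

lemma component_maximal:
  assumes "path r" "set r \<inter> set q = {}" "a \<in> set r"
  shows "set r \<subseteq> component q a"
proof (rule path_in_or_out[OF assms(1)])
  have "a \<in> V" "a \<notin> set q" using assms by (auto simp: path_def)
  from piece_component[OF this]
  show "set r \<inter> boundary (component q a) = {}" "set r \<inter> component q a \<noteq> {}"
    using assms by (auto simp: piece_def)
qed

lemma outside_piece_absorbed:
  assumes "piece p H" "a \<in> boundary H" "a \<notin> set q" "H \<inter> set q = {}"
  shows "insert a H \<subseteq> component q a"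
proof
  fix v assume v: "v \<in> insert a H"
  obtain h where h: "h \<in> H" "E a h" using boundary_edge[OF assms(2)] by blast
  have a: "a \<in> V" "a \<notin> H" using assms(2) by (auto simp: boundary_def)
  show "v \<in> component q a"
  proof (cases "v = a")
    case True
    then show ?thesis using piece_component(2) a assms(3) by simp
  next
    case False
    then obtain r where r: "path r" "hd r = h" "last r = v" "set r \<subseteq> H"
      using v h assms(1) unfolding piece_def linked_def by blast
    have ne: "r \<noteq> []" using r(1) by (simp add: path_def)
    have "path (a # r)" using r h a by (auto simp: path_Cons)
    moreover have "set (a # r) \<inter> set q = {}" using r(4) assms(3,4) by auto
    ultimately have "set (a # r) \<subseteq> component q a" by (rule component_maximal) simp
    then show ?thesis using r(3) ne last_in_set[OF ne] by auto
  qed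
qed

text \<open>
  Either side of \<open>c\<close> on \<open>p\<close> lies in \<open>K\<close> as soon as it meets \<open>K\<close>, as the side of \<open>a\<close> does. Let \<open>a\<close>
  precede \<open>c\<close>. Then the start of \<open>p\<close> is in \<open>K\<close>, and so is the successor of \<open>a\<close> unless it is \<open>c\<close>; in
  that case \<open>b \<noteq> c\<close>, since boundary vertices are not consecutive, so \<open>b\<close> and its successor are in
  \<open>K\<close>. If \<open>a\<close> comes after \<open>c\<close>, the successor of \<open>a\<close> is in \<open>K\<close>, together with the start if \<open>b\<close>
  precedes \<open>c\<close>, and with the successor of \<open>b\<close> otherwise.
\<close>

lemma two_certificate_vertices:
  assumes p: "longest p" and H: "piece p H" and N: "boundary H = {a, b}" "a \<noteq> b"
    and sub: "insert a H \<subseteq> K" and K: "boundary K = {c}" and c: "c \<in> set p"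
  shows "2 \<le> card (certificate p (boundary H) \<inter> K)"
proof -
  have pp: "path p" "distinct p" using p by (auto simp: longest_def path_def)
  obtain k where k: "k < length p" "p ! k = c" using c by (auto simp: in_set_conv_nth)
  have "{a, b} \<subseteq> set p" using H N by (auto simp: piece_def)
  then obtain i j where i: "i < length p" "p ! i = a" and j: "j < length p" "p ! j = b"
    by (auto simp: in_set_conv_nth)
  have cK: "c \<notin> K" using K by (auto simp: boundary_def)
  have aK: "a \<in> K" using sub by simp
  have bK: "b \<in> K \<or> b = c"
  proof -
    have "b \<in> boundary H" using N by simp
    then have "b \<in> K \<or> b \<in> boundary K" using sub by (auto simp: boundary_def)
    then show ?thesis using K by simp
  qed
  note split = id_take_nth_drop[OF k(1)]
  have side: "set (take k p) \<inter> K \<noteq> {} \<Longrightarrow> set (take k p) \<subseteq> K"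
    "set (drop (Suc k) p) \<inter> K \<noteq> {} \<Longrightarrow> set (drop (Suc k) p) \<subseteq> K"
    using sides_in_or_out[of "take k p" c "drop (Suc k) p" K] pp(1) split k(2) K by auto
  have before: "p ! m' \<in> K" if "p ! m \<in> K" "m < k" "m' < k" for m m'
  proof -
    have "p ! m \<in> set (take k p)" "p ! m' \<in> set (take k p)"
      using that k(1) by (auto simp: in_set_conv_nth)
    then show ?thesis using side(1) that(1) by blast
  qed
  have after: "p ! m' \<in> K" if "p ! m \<in> K" "k < m" "m < length p" "k < m'" "m' < length p" for m m'
  proof -
    have mem: "p ! x \<in> set (drop (Suc k) p)" if "k < x" "x < length p" for x
      using that by (auto simp: in_set_conv_nth intro!: exI[of _ "x - Suc k"])
    show ?thesis using side(2) mem[OF that(2,3)] mem[OF that(4,5)] that(1) by blast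
  qed
  have inner: "Suc i < length p" "Suc j < length p"
    using boundary_index_inner(2)[OF p H] i j N by auto
  have "p ! Suc i \<notin> boundary H" "p ! Suc j \<notin> boundary H"
    using successor_not_boundary[OF p H] inner i j N by auto
  then have nonconsecutive: "Suc i \<noteq> j" "Suc j \<noteq> i" using i j N by auto
  have ij: "i \<noteq> j" "i \<noteq> k" using i j k N(2) aK cK by auto
  have jk: "j = k \<or> p ! j \<in> K" using bK j k pp(2) by (auto simp: nth_eq_iff_index_eq)
  have iK: "p ! i \<in> K" using i aK by simp
  let ?I = "{0, Suc i, Suc j}"
  have "\<exists>m\<in>?I. \<exists>m'\<in>?I. m \<noteq> m' \<and> p ! m \<in> K \<and> p ! m' \<in> K"
  proof (cases "i < k")
    case True
    then have 0: "p ! 0 \<in> K" using before[OF iK] by simp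
    have "p ! Suc i \<in> K \<or> p ! Suc j \<in> K"
    proof (cases "Suc i < k")
      case False
      then have "Suc i = k" using True by simp
      then have "p ! j \<in> K" "j < i \<or> k < j" using jk nonconsecutive ij by auto
      then show ?thesis using before[of j "Suc j"] after[of j "Suc j"] \<open>Suc i = k\<close> inner(2) by auto
    qed (use before[OF iK True] in simp)
    then show ?thesis using 0 by auto
  next
    case False
    then have ik: "k < i" using ij by simp
    then have si: "p ! Suc i \<in> K" using after[OF iK] i inner by simp
    have "p ! 0 \<in> K \<or> p ! Suc j \<in> K"
    proof (cases "j < k")
      case True
      then show ?thesis using before[of j 0] jk by auto
    next
      case False
      then show ?thesis using after[OF iK ik i(1), of "Suc j"] inner by simp
    qed
    then show ?thesis using si ij by auto
  qed
  then obtain m m' where m: "m \<in> ?I" "m' \<in> ?I" "m \<noteq> m'" "p ! m \<in> K" "p ! m' \<in> K" by blast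
  have "m < length p" "m' < length p" using m(1,2) inner by auto
  then have "p ! m \<noteq> p ! m'" using m(3) pp(2) by (simp add: nth_eq_iff_index_eq)
  moreover have "{p ! m, p ! m'} \<subseteq> certificate p (boundary H) \<inter> K"
    using m i j N unfolding certificate_def by auto
  moreover have "finite (certificate p (boundary H))" by (simp add: certificate_def)
  ultimately show ?thesis
    by (metis card_2_iff card_mono finite_Int)
qed

lemma boundary_of_maximal_piece_gallai:
  assumes alpha: "\<And>S. indep S \<Longrightarrow> card S \<le> 4"
    and p: "longest p" and H: "piece p H"
    and maximal: "\<And>q K. longest q \<Longrightarrow> piece q K \<Longrightarrow> card (boundary K) < card (boundary H) \<or>
      card (boundary K) = card (boundary H) \<and> card K \<le> card H"
    and a: "a \<in> boundary H" and q: "longest q"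
  shows "a \<in> set q"
proof (rule ccontr)
  assume aq: "a \<notin> set q"
  have bound: "Suc (card (boundary K) + card I) \<le> 4"
    if "longest r" "piece r K" "I \<subseteq> K" "indep I" for r K I
    using indep_certificate[OF that] alpha by metis
  have fin: "finite A" if "A \<subseteq> V" for A using that finite_V finite_subset by blast
  have Hp: "H \<subseteq> V" "H \<inter> set p = {}" "H \<noteq> {}" "boundary H \<subseteq> set p"
    using H by (auto simp: piece_def)
  have pp: "path p" and qq: "path q" using p q by (auto simp: longest_def)
  have aV: "a \<in> V" and ap: "a \<in> set p" using a Hp by (auto simp: boundary_def)
  define K where "K = component q a"
  have K: "piece q K" and aK: "a \<in> K" unfolding K_def using piece_component[OF aV aq] by auto
  have Kp: "K \<subseteq> V" "K \<inter> set q = {}" "boundary K \<subseteq> set q" using K by (auto simp: piece_def)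
  have "\<not> set p \<subseteq> K" using longest_paths_meet[OF p q] Kp by auto
  then obtain c where c: "c \<in> boundary K" "c \<in> set p"
    using path_in_or_out[OF pp, of K] ap aK by blast
  have "\<not> set q \<subseteq> H" using longest_paths_meet[OF p q] Hp by auto
  show False
  proof (cases "H \<inter> set q = {}")
    case True
    \<comment> \<open>\<open>K\<close> outgrows \<open>H\<close>, so its boundary is smaller and its independent sets have at most two vertices\<close>
    have sub: "insert a H \<subseteq> K" unfolding K_def by (rule outside_piece_absorbed[OF H a aq True])
    have "card (insert a H) \<le> card K" by (rule card_mono) (use sub fin Kp in auto)
    moreover have "a \<notin> H" using a by (auto simp: boundary_def)
    ultimately have "card H < card K" using fin[OF Hp(1)] by simp
    then have less: "card (boundary K) < card (boundary H)" using maximal[OF q K] by auto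
    obtain h where h: "h \<in> H" using Hp by blast
    have ih: "indep {h}" "{h} \<subseteq> H" using h Hp edge_irrefl by (auto simp: indep_def)
    have "Suc (card (boundary H) + 1) \<le> 4" using bound[OF p H ih(2,1)] by simp
    moreover have "0 < card (boundary K)"
      using c fin[of "boundary K"] by (auto simp: boundary_def card_gt_0_iff)
    ultimately have "card (boundary H) = 2" "card (boundary K) = 1" using less by auto
    then obtain b where N: "boundary H = {a, b}" "a \<noteq> b" "boundary K = {c}"
      using a c(1) by (auto simp: card_2_iff card_1_singleton_iff doubleton_eq_iff)
    let ?C = "certificate p (boundary H)"
    have two: "2 \<le> card (?C \<inter> K)"
      by (rule two_certificate_vertices[OF p H N(1,2) sub N(3) c(2)])
    have "indep (?C \<union> {h})" by (rule indep_certificate(1)[OF p H ih(2,1)])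
    then have I: "indep (insert h (?C \<inter> K))" by (auto simp: indep_def)
    have "?C \<subseteq> set p" using boundary_index_inner(2)[OF p H] pp
      by (auto simp: certificate_def path_def)
    then have "h \<notin> ?C" using h Hp by auto
    moreover have "finite ?C" by (simp add: certificate_def)
    ultimately have "card (insert h (?C \<inter> K)) = Suc (card (?C \<inter> K))" by simp
    moreover have "Suc (card (boundary K) + card (insert h (?C \<inter> K))) \<le> 4"
      by (rule bound[OF q K _ I]) (use h sub in auto)
    ultimately show False using two N(3) by simp
  next
    case False
    \<comment> \<open>\<open>q\<close> covers \<open>H\<close>, so \<open>K\<close> has two boundary vertices and is too small for its side of \<open>c\<close> on \<open>p\<close>\<close>
    then obtain b where b: "b \<in> boundary H" "b \<in> set q"
      using path_in_or_out[OF qq, of H] \<open>\<not> set q \<subseteq> H\<close> by blast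
    have ab: "a \<noteq> b" using aq b by auto
    have finN: "finite (boundary H)" using fin by (auto simp: boundary_def)
    have "card {a, b} \<le> card (boundary H)" by (rule card_mono) (use finN a b in auto)
    then have two: "2 \<le> card (boundary H)" using ab by simp
    have clique: "clique H" unfolding clique_def
    proof (intro ballI impI, rule ccontr)
      fix u v assume uv: "u \<in> H" "v \<in> H" "u \<noteq> v" "\<not> E u v"
      then have "indep {u, v}" "{u, v} \<subseteq> H"
        using Hp edge_irrefl edge_sym by (auto simp: indep_def)
      from bound[OF p H this(2,1)] show False using uv two by simp
    qed
    obtain h where ih: "h \<in> H" using Hp by blast
    have "Suc (card (boundary H) + card {h}) \<le> 4"
      by (rule bound[OF p H]) (use ih Hp edge_irrefl in \<open>auto simp: indep_def\<close>)
    then have two': "card (boundary H) = 2" using two by simp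
    have Nab: "boundary H = {a, b}"
      by (rule card_seteq[symmetric]) (use finN a b ab two' in auto)
    obtain ys zs where q_split: "q = ys @ b # zs" using b(2) by (meson split_list)
    have side: "set ys \<inter> H \<noteq> {} \<Longrightarrow> set ys \<subseteq> H" "set zs \<inter> H \<noteq> {} \<Longrightarrow> set zs \<subseteq> H"
      using sides_in_or_out[of ys b zs H] qq aq Nab q_split by auto
    have "b \<notin> H" using b by (auto simp: boundary_def)
    then have "set ys \<inter> H \<noteq> {} \<or> set zs \<inter> H \<noteq> {}" using False q_split by auto
    then have ends: "hd q \<in> H \<or> last q \<in> H"
    proof
      assume ne: "set ys \<inter> H \<noteq> {}"
      then have "ys \<noteq> []" by auto
      then have "hd ys \<in> H" using side(1)[OF ne] hd_in_set by blast
      then show ?thesis using q_split \<open>ys \<noteq> []\<close> by simp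
    next
      assume ne: "set zs \<inter> H \<noteq> {}"
      then have "zs \<noteq> []" by auto
      then have "last zs \<in> H" using side(2)[OF ne] last_in_set by blast
      then show ?thesis using q_split \<open>zs \<noteq> []\<close> by simp
    qed
    have Hq: "w \<in> set q" if w: "w \<in> H" for w
    proof (rule ccontr)
      assume wq: "w \<notin> set q"
      have ne: "q \<noteq> []" using qq by (simp add: path_def)
      have wV: "w \<in> V" using w Hp by auto
      from ends show False
      proof
        assume "hd q \<in> H"
        moreover have "w \<noteq> hd q" using wq hd_in_set[OF ne] by metis
        ultimately have "E w (hd q)" using clique w by (simp add: clique_def)
        then have "path (w # q)" using qq wq wV by (simp add: path_Cons)
        from longest_length[OF q this] show False by simp
      next
        assume "last q \<in> H"
        moreover have "last q \<noteq> w" using wq last_in_set[OF ne] by metis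
        ultimately have "E (last q) w" using clique w by (simp add: clique_def)
        then have "path (q @ [w])" using qq wq wV ne by (simp add: path_append)
        from longest_length[OF q this] show False by simp
      qed
    qed
    obtain w where w: "w \<in> H" "E a w" using boundary_edge[OF a] by blast
    have "w \<in> V" "w \<notin> K" "E w a" using Hq[OF w(1)] w Kp Hp edge_sym by auto
    then have "w \<in> boundary K" using aK by (auto simp: boundary_def)
    moreover have wc: "w \<noteq> c" using w c Hp by auto
    moreover have finK: "finite (boundary K)" using fin by (auto simp: boundary_def)
    ultimately have "card {w, c} \<le> card (boundary K)" using c by (intro card_mono) auto
    then have K2: "card (boundary K) = 2" "card K \<le> card H"
      using maximal[OF q K] two' wc by auto
    have Kwc: "boundary K = {w, c}"
      by (rule card_seteq[symmetric]) (use finK c wc K2 \<open>w \<in> boundary K\<close> in auto)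
    have wp: "w \<notin> set p" using w Hp by auto
    obtain us vs where p_split: "p = us @ c # vs" using c(2) by (meson split_list)
    have side: "set us \<inter> K \<noteq> {} \<Longrightarrow> set us \<subseteq> K" "set vs \<inter> K \<noteq> {} \<Longrightarrow> set vs \<subseteq> K"
      using sides_in_or_out[of us c vs K] pp wp Kwc p_split by auto
    have dist: "distinct us" "distinct vs" using pp p_split by (auto simp: path_def)
    have "c \<notin> K" using c by (auto simp: boundary_def)
    then have "a \<in> set us \<or> a \<in> set vs" using ap aK p_split by auto
    then show False
    proof
      \<comment> \<open>the arm of \<open>a\<close> that points away from \<open>c\<close> is the one contained in \<open>K\<close>\<close>
      assume au: "a \<in> set us"
      then obtain us1 us2 where us: "us = us1 @ a # us2" by (meson split_list)
      have "card H \<le> length us1"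
        using left_arm_at_boundary_of_clique[of us1 a "us2 @ c # vs" H] p H a clique p_split us by simp
      moreover have "length us \<le> card K"
        using card_mono[OF fin[OF Kp(1)] side(1)] au aK distinct_card[OF dist(1)] by auto
      ultimately show False using K2(2) us by simp
    next
      assume av: "a \<in> set vs"
      then obtain vs1 vs2 where vs: "vs = vs1 @ a # vs2" by (meson split_list)
      have "card H \<le> length vs2"
        using right_arm_at_boundary_of_clique[of "us @ c # vs1" a vs2 H] p H a clique p_split vs by simp
      moreover have "length vs \<le> card K"
        using card_mono[OF fin[OF Kp(1)] side(2)] av aK distinct_card[OF dist(2)] by auto
      ultimately show False using K2(2) vs by simp
    qed
  qed
qed

theorem common_vertex_of_longest_paths:
  assumes alpha: "\<And>S. indep S \<Longrightarrow> card S \<le> 4" and ne: "V \<noteq> {}"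
  shows "\<exists>v\<in>V. \<forall>p. longest p \<longrightarrow> v \<in> set p"
proof (cases "\<exists>p H. longest p \<and> piece p H")
  case False
  obtain v where v: "v \<in> V" using ne by blast
  have "v \<in> set p" if "longest p" for p
    using False piece_component(1)[OF v] that by blast
  then show ?thesis using v by blast
next
  case True
  let ?M = "card V + 1"
  \<comment> \<open>the lexicographic order on \<open>(|N(H)|, |H|)\<close> as a single number, as \<open>|H| < |V| + 1\<close>\<close>
  define f where "f H = card (boundary H) * ?M + card H" for H
  let ?P = "\<lambda>x. longest (fst x) \<and> piece (fst x) (snd x)"
  have le: "card H \<le> card V" "card (boundary H) \<le> card V" if "piece p H" for p H
    using that finite_V by (auto simp: piece_def boundary_def intro!: card_mono)
  obtain p0 H0 where P0: "?P (p0, H0)" using True by auto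
  have bounded: "\<forall>x. ?P x \<longrightarrow> f (snd x) < Suc (card V * ?M + card V)"
  proof (intro allI impI)
    fix x assume "?P x"
    from le[OF conjunct2[OF this]] show "f (snd x) < Suc (card V * ?M + card V)"
      unfolding f_def less_Suc_eq_le by (intro add_mono mult_le_mono1)
  qed
  obtain x where x: "?P x" "\<forall>y. ?P y \<longrightarrow> f (snd y) \<le> f (snd x)"
    using ex_has_greatest_nat[of ?P "(p0, H0)" "\<lambda>x. f (snd x)", OF P0 bounded] by blast
  define p H where "p = fst x" and "H = snd x"
  have pH: "longest p" "piece p H" using x(1) by (auto simp: p_def H_def)
  have fmax: "f K \<le> f H" if "longest q" "piece q K" for q K
    using spec[OF x(2), of "(q, K)"] that by (simp add: H_def)
  have maximal: "card (boundary K) < card (boundary H) \<or>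
      card (boundary K) = card (boundary H) \<and> card K \<le> card H"
    if "longest q" "piece q K" for q K
  proof -
    have "\<not> card (boundary H) < card (boundary K)"
    proof
      assume "card (boundary H) < card (boundary K)"
      then have "Suc (card (boundary H)) * ?M \<le> card (boundary K) * ?M"
        by (intro mult_le_mono1) simp
      then show False using fmax[OF that] le(1)[OF pH(2)] by (simp add: f_def)
    qed
    then show ?thesis using fmax[OF that] by (auto simp: f_def)
  qed
  obtain a where a: "a \<in> boundary H" using piece_boundary_nonempty[OF pH] by blast
  then have "a \<in> V" by (auto simp: boundary_def)
  moreover have "a \<in> set q" if "longest q" for q
    by (rule boundary_of_maximal_piece_gallai[OF _ pH _ a that])
      (erule alpha, erule (1) maximal)
  ultimately show ?thesis by blast
qed

end

section \<open>Pair graphs\<close>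

lemma card_le_independence_number:
  assumes "finite (pverts G)" "independent_set G S"
  shows "card S \<le> independence_number G"
proof -
  have "{S. independent_set G S} \<subseteq> Pow (pverts G)" by (auto simp: independent_set_def)
  then have "finite {S. independent_set G S}" using assms(1) by (meson finite_Pow_iff finite_subset)
  then show ?thesis using assms(2) by (simp add: independence_number_def)
qed

lemma independence_number_attained:
  assumes "finite (pverts G)"
  shows "\<exists>S. independent_set G S \<and> card S = independence_number G"
proof -
  have "{S. independent_set G S} \<subseteq> Pow (pverts G)" by (auto simp: independent_set_def)
  then have "finite {S. independent_set G S}" using assms(1) by (meson finite_Pow_iff finite_subset)
  moreover have "independent_set G {}" by (simp add: independent_set_def)
  ultimately have "independence_number G \<in> card ` {S. independent_set G S}"
    unfolding independence_number_def by (intro Max_in) auto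
  then show ?thesis by auto
qed

lemma vwalk_arcs_subset_iff_successively:
  "set (vwalk_arcs p) \<subseteq> R \<longleftrightarrow> successively (\<lambda>u v. (u, v) \<in> R) p"
  by (induction p rule: vwalk_arcs.induct) auto

lemma pair_graph_finite_connected:
  assumes "pair_graph G" "Digraph_Component.connected (with_proj G)"
  shows "finite_connected_graph (pverts G) (\<lambda>u v. (u, v) \<in> parcs G)"
proof -
  interpret pair_graph G by fact
  have sym: "(v, u) \<in> parcs G" if "(u, v) \<in> parcs G" for u v
    using pair_sym_arcs that by (auto simp: symmetric_def sym_def)
  show ?thesis
  proof
    show "finite (pverts G)" by (rule pair_finite_verts)
    show "u \<in> pverts G" if "(u, v) \<in> parcs G" for u v using that by (rule in_arcsD1)
    show "(v, u) \<in> parcs G" if "(u, v) \<in> parcs G" for u v by (rule sym) fact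
    show "(v, v) \<notin> parcs G" for v using pair_no_loops[of "(v, v)"] by auto
    show "(\<lambda>u v. (u, v) \<in> parcs G)\<^sup>*\<^sup>* u v" if "u \<in> pverts G" "v \<in> pverts G" for u v
    proof -
      have "(u, v) \<in> rtrancl_on (pverts G) (parcs (mk_symmetric (with_proj G)))"
        using assms(2) that
        by (simp add: Digraph_Component.connected_def strongly_connected_def reachable_def
            mk_symmetric_def)
      then show ?thesis
      proof induction
        case (step y z)
        then have "(y, z) \<in> parcs G" by (auto simp: mk_symmetric_def sym)
        then show ?case
          using step.IH converse_rtranclp_into_rtranclp[of "\<lambda>u v. (u, v) \<in> parcs G" y z v]
          by blast
      qed simp
    qed
  qed
qed

lemma gallai_vertex_if_independence_number_le_4:
  assumes G: "pair_graph G" "Digraph_Component.connected (with_proj G)"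
    and alpha: "independence_number G \<le> 4"
  shows "\<exists>v. gallai_vertex G v"
proof -
  interpret finite_connected_graph "pverts G" "\<lambda>u v. (u, v) \<in> parcs G"
    by (rule pair_graph_finite_connected[OF G])
  have path: "vpath p (with_proj G) \<longleftrightarrow> path p" for p
    by (auto simp: vpath_def vwalk_def path_def vwalk_arcs_subset_iff_successively)
  have "longest p" if "longest_path G p" for p
    unfolding longest_def
  proof (intro conjI allI impI)
    show p: "path p" using that by (simp add: longest_path_def path)
    fix q assume q: "path q"
    then have "length q - 1 \<le> length p - 1" using that by (simp add: longest_path_def path)
    then show "length q \<le> length p" using p by (cases p) (auto simp: path_def)
  qed
  moreover have "card S \<le> 4" if "indep S" for S
    using card_le_independence_number[OF finite_V, of S] that alpha
    by (simp add: indep_def independent_set_def)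
  moreover have "pverts G \<noteq> {}"
    using G(2) by (simp add: Digraph_Component.connected_def strongly_connected_def mk_symmetric_def)
  ultimately show ?thesis
    using common_vertex_of_longest_paths unfolding gallai_vertex_def by meson
qed

lemma pair_graph_edgeless: "pair_graph (edgeless_graph n)"
  by unfold_locales (auto simp: edgeless_graph_def symmetric_def sym_def)

text \<open>
  Any \<open>n\<close> vertices of an independent set of size at least \<open>n\<close> induce a copy of the edgeless graph.
\<close>

lemma independence_number_less_if_edgeless_free:
  fixes G :: "'a pair_pre_digraph"
  assumes "pair_graph G" "induced_free (edgeless_graph n) G"
  shows "independence_number G < n"
proof (rule ccontr)
  assume "\<not> independence_number G < n"
  interpret pair_graph G by fact
  obtain T where T: "independent_set G T" "n \<le> card T"
    using independence_number_attained[OF pair_finite_verts] \<open>\<not> _\<close> by auto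
  then obtain S where S: "S \<subseteq> T" "card S = n" "finite S"
    using obtain_subset_with_card_n by metis
  then obtain f where f: "bij_betw f S {..<n}"
    using ex_bij_betw_finite_nat by (metis atLeast0LessThan)
  define K :: "('a, 'a \<times> 'a) pre_digraph" where "K = with_proj \<lparr> pverts = S, parcs = {} \<rparr>"
  have wf: "wf_digraph K" unfolding K_def by unfold_locales auto
  have indep: "S \<subseteq> pverts G" "\<And>u v. u \<in> S \<Longrightarrow> v \<in> S \<Longrightarrow> (u, v) \<notin> parcs G"
    using T S by (auto simp: independent_set_def)
  have "induced_subgraph K (with_proj G)"
    using wf indep wf_digraph_axioms
    by (auto simp: induced_subgraph_def subgraph_def compatible_def K_def)
  moreover have "digraph_iso K (with_proj (edgeless_graph n))"
    unfolding digraph_iso_def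
  proof (intro exI conjI)
    let ?h = "\<lparr> iso_verts = f, iso_arcs = map_prod f f, iso_head = snd, iso_tail = fst \<rparr>"
    show "pre_digraph.digraph_isomorphism K ?h"
      using wf f by (simp add: pre_digraph.digraph_isomorphism_def K_def bij_betw_def)
    show "with_proj (edgeless_graph n) = app_iso ?h K"
      using f by (simp add: app_iso_def K_def with_proj_def edgeless_graph_def bij_betw_def)
  qed
  ultimately show False using assms(2) unfolding induced_free_def by blast
qed

theorem theorem17:
  shows "(\<forall>G :: 'a pair_pre_digraph.
            pair_graph G \<longrightarrow> Digraph_Component.connected (with_proj G) \<longrightarrow>
            independence_number G \<le> 4 \<longrightarrow> (\<exists>v. gallai_vertex G v))
         \<and> fixer TYPE('a) (edgeless_graph 5)"
proof (intro conjI allI impI)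
  fix G :: "'a pair_pre_digraph"
  assume "pair_graph G" "Digraph_Component.connected (with_proj G)" "independence_number G \<le> 4"
  then show "\<exists>v. gallai_vertex G v" by (rule gallai_vertex_if_independence_number_le_4)
next
  show "fixer TYPE('a) (edgeless_graph 5)"
    unfolding fixer_def
  proof (intro conjI allI impI)
    show "pair_graph (edgeless_graph 5)" by (rule pair_graph_edgeless)
    fix G :: "'a pair_pre_digraph"
    assume G: "pair_graph G" "Digraph_Component.connected (with_proj G)"
      and free: "induced_free (edgeless_graph 5) G"
    have "independence_number G \<le> 4"
      using independence_number_less_if_edgeless_free[OF G(1) free] by simp
    then show "\<exists>v. gallai_vertex G v" by (rule gallai_vertex_if_independence_number_le_4[OF G])
  qed
qed

end
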